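(* Let $A$ be a $d\times n$ integer matrix of rank $d$ with columns $\mathbf{a}_1,\dots,\mathbf{a}_n$ and $\ker(A)\cap\mathbb{R}^n_{\ge0}=\{\mathbf{0}\}$. Let $\gamma$ be an external chamber of $A$ whose external columns are $\mathbf{a}_1,\dots,\mathbf{a}_{d-1}$, and assume $\mathcal{S}(\mathbf{a}_1,\dots,\mathbf{a}_{d-1})$ is saturated in $\mathcal{L}(A)$. Let $\mathbf{v}_1,\dots,\mathbf{v}_{d-1}\in\mathbb{Z}^d$ be the external ray generators of $\gamma$ corresponding to $\mathbf{a}_1,\dots,\mathbf{a}_{d-1}$ respectively (i.e. $\mathbf{v}_i$ generates the ray $\operatorname{pos}_{\mathbb{R}}(\mathbf{a}_i)$), and let $\mathbf{v}_d\in\mathbb{Z}^d$ be an internal ray generator of $\gamma$. Let $h(t):=p_A(t\mathbf{v}_d)$ be the Ehrhart quasi-polynomial of the polytope $\{\mathbf{x}\ge\mathbf{0}: A\mathbf{x}=\mathbf{v}_d\}$. Then $$p_A^\gamma(\mathbf{b})=h\!\left(\frac{\det(\mathbf{v}_1,\dots,\mathbf{v}_{d-1},\mathbf{b})}{\det(\mathbf{v}_1,\mathbf{v}_2,\dots,\mathbf{v}_d)}\right)$$ for all $\mathbf{b}\in\gamma\cap\mathcal{S}(A)$.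
   Context: $\operatorname{pos}_{\mathbb{R}}(\cdot)$ denotes the cone of nonnegative real combinations. A simplicial cone of $A$ is $\operatorname{pos}_{\mathbb{R}}(A_s)$ where $A_s$ is a set $s$ of columns with $|s|=\operatorname{rank}(A_s)=d$. The chamber complex of $A$ is the fan formed by the cones $\bigcap\{\text{simplicial cones of }A\text{ containing }\mathbf{b}\}$, $\mathbf{b}\in\operatorname{pos}_{\mathbb{R}}(A)$, with all faces; its $d$-dimensional cones are chambers. $p_A(\mathbf{b})=\#\{\mathbf{x}\in\mathbb{N}^n:A\mathbf{x}=\mathbf{b}\}$ and $p_A^\gamma$ is the quasi-polynomial agreeing with $p_A$ on $\gamma\cap\mathbb{Z}^d$. A column $\mathbf{a}_j$ is an external column if $\mathbf{a}_j$ is not in the cone generated by the other columns. A chamber $\gamma$ is external if all but exactly one of its rays are generated by external columns of $A$; these rays are its external rays (their generators are external ray generators) and the remaining ray is its internal ray (its generators are internal ray generators). $\mathcal{L}(\cdot)$ and $\mathcal{S}(\cdot)$ are the lattice and $\mathbb{N}$-semigroup generated by the given vectors; $\mathcal{S}(A_s)$ is saturated in $\mathcal{L}(A)$ if $\mathcal{S}(A_s)=\mathcal{L}(A)\cap\operatorname{pos}_{\mathbb{R}}(A_s)$.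
   Formalization: As stated the formula can fail when t·v_d is not in L(A) (t the determinant quotient); here h is instead some quasi-polynomial of a real argument, shown to exist, with h(t)=p_A(t v_d) for all t≥0, integral or not, such that t v_d lies in L(A). *)

theory Defs
  imports "HOL-Analysis.Analysis"
begin

definition real_vec :: "int^'d \<Rightarrow> real^'d" where
  "real_vec v = (\<chi> i. real_of_int (v $ i))"

definition real_mat :: "int^'n^'d \<Rightarrow> real^'n^'d" where
  "real_mat A = map_matrix real_of_int A"

definition cols :: "int^'n^'d \<Rightarrow> 'n set \<Rightarrow> (int^'d) set" where
  "cols A s = (\<lambda>j. column j A) ` s"

text \<open>The next three definitions are meant for finite \<open>S\<close>
  (a sum over an infinite set is 0 in HOL).\<close>

definition pos :: "(int^'d) set \<Rightarrow> (real^'d) set" where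
  "pos S = {\<Sum>v\<in>S. c v *\<^sub>R real_vec v | c. \<forall>v\<in>S. 0 \<le> c v}"

definition lattice_gen :: "(int^'d) set \<Rightarrow> (int^'d) set" where
  "lattice_gen S = {\<Sum>v\<in>S. c v *s v | c. True}"

definition semigroup_gen :: "(int^'d) set \<Rightarrow> (int^'d) set" where
  "semigroup_gen S = {\<Sum>v\<in>S. int (c v) *s v | c. True}"

definition saturated_in :: "(int^'d) set \<Rightarrow> (int^'d) set \<Rightarrow> bool" where
  "saturated_in S L \<longleftrightarrow> semigroup_gen S = {b \<in> L. real_vec b \<in> pos S}"

definition partition_fun :: "int^'n^'d \<Rightarrow> int^'d \<Rightarrow> nat" where
  "partition_fun A b = card {x :: nat^'n. A *v (\<chi> j. int (x $ j)) = b}"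

definition simplicial_cones :: "int^'n^'d \<Rightarrow> (real^'d) set set" where
  "simplicial_cones A =
    {pos (cols A s) | s. card s = CARD('d) \<and> dim (real_vec ` cols A s) = CARD('d)}"

definition chamber_complex :: "int^'n^'d \<Rightarrow> (real^'d) set set" where
  "chamber_complex A =
    {F. F \<noteq> {} \<and> (\<exists>b \<in> pos (cols A UNIV). F face_of \<Inter>{\<sigma> \<in> simplicial_cones A. b \<in> \<sigma>})}"

definition chamber :: "int^'n^'d \<Rightarrow> (real^'d) set \<Rightarrow> bool" where
  "chamber A \<gamma> \<longleftrightarrow> \<gamma> \<in> chamber_complex A \<and> aff_dim \<gamma> = int CARD('d)"

definition ray_of :: "(real^'d) set \<Rightarrow> (real^'d) set \<Rightarrow> bool" where
  "ray_of R \<gamma> \<longleftrightarrow> R face_of \<gamma> \<and> aff_dim R = 1"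

definition external_column :: "int^'n^'d \<Rightarrow> 'n \<Rightarrow> bool" where
  "external_column A j \<longleftrightarrow> real_vec (column j A) \<notin> pos (cols A (- {j}))"

definition external_ray :: "int^'n^'d \<Rightarrow> (real^'d) set \<Rightarrow> (real^'d) set \<Rightarrow> bool" where
  "external_ray A \<gamma> R \<longleftrightarrow> ray_of R \<gamma> \<and> (\<exists>j. external_column A j \<and> R = pos {column j A})"

definition internal_ray :: "int^'n^'d \<Rightarrow> (real^'d) set \<Rightarrow> (real^'d) set \<Rightarrow> bool" where
  "internal_ray A \<gamma> R \<longleftrightarrow> ray_of R \<gamma> \<and> \<not> external_ray A \<gamma> R"

definition external_chamber :: "int^'n^'d \<Rightarrow> (real^'d) set \<Rightarrow> bool" where
  "external_chamber A \<gamma> \<longleftrightarrow> chamber A \<gamma> \<and> (\<exists>!R. internal_ray A \<gamma> R)"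

definition external_columns_of :: "int^'n^'d \<Rightarrow> (real^'d) set \<Rightarrow> 'n set" where
  "external_columns_of A \<gamma> = {j. external_column A j \<and> ray_of (pos {column j A}) \<gamma>}"

text \<open>Quasi-polynomials on the integer lattice: polynomial on each class modulo some \<open>N\<close>.
  Every sublattice of finite index contains the multiples of such an \<open>N\<close>, so this covers
  arbitrary finite-index sublattices of periods.\<close>
definition quasi_polynomial :: "(int^'d \<Rightarrow> real) \<Rightarrow> bool" where
  "quasi_polynomial P \<longleftrightarrow>
    (\<exists>N>0. \<forall>r. \<exists>q. real_polynomial_function q \<and>
      (\<forall>b. (\<forall>i. b $ i mod int N = r $ i mod int N) \<longrightarrow> P b = q (real_vec b)))"

text \<open>The defining property of the quasi-polynomial of a chamber.  It has at most one
  solution, because a chamber is full-dimensional.\<close>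
definition chamber_quasi_polynomial ::
  "int^'n^'d \<Rightarrow> (real^'d) set \<Rightarrow> (int^'d \<Rightarrow> real) \<Rightarrow> bool" where
  "chamber_quasi_polynomial A \<gamma> P \<longleftrightarrow>
    quasi_polynomial P \<and> (\<forall>b. real_vec b \<in> \<gamma> \<longrightarrow> P b = real (partition_fun A b))"

text \<open>Quasi-polynomials in one variable that may be evaluated at non-integral arguments.
  The period \<open>N\<close> must be an integer: with an irrational period the coefficients would be
  unconstrained on the rationals.\<close>
definition quasi_polynomial_1 :: "(real \<Rightarrow> real) \<Rightarrow> bool" where
  "quasi_polynomial_1 h \<longleftrightarrow>
    (\<exists>(N::nat)>0. \<exists>m c. (\<forall>i t. c i (t + real N) = c i t) \<and>
      (\<forall>t. h t = (\<Sum>i\<le>m. c i t * t ^ i)))"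

text \<open>The function \<open>t \<mapsto> p\<^sub>A(t v)\<close> counts the lattice points of the dilates of
  \<open>{x \<ge> 0. A x = v}\<close>.  It vanishes for the trivial reason that \<open>A x = t v\<close> has no integral
  solution at all unless \<open>t v\<close> lies in the lattice of \<open>A\<close>, so an Ehrhart quasi-polynomial that
  is to be evaluated at quotients of determinants is a quasi-polynomial with the values
  \<open>p\<^sub>A(t v)\<close> at all (not only integral) \<open>t \<ge> 0\<close> with \<open>t v\<close> in that lattice.\<close>
definition ehrhart_quasi_polynomial ::
  "int^'n^'d \<Rightarrow> int^'d \<Rightarrow> (real \<Rightarrow> real) \<Rightarrow> bool" where
  "ehrhart_quasi_polynomial A v h \<longleftrightarrow>
    quasi_polynomial_1 h \<and>
    (\<forall>t\<ge>0. \<forall>w \<in> lattice_gen (cols A UNIV).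
      real_vec w = t *\<^sub>R real_vec v \<longrightarrow> h t = real (partition_fun A w))"

definition det_columns :: "('d \<Rightarrow> int^'d) \<Rightarrow> int" where
  "det_columns v = det (\<chi> i j. v j $ i)"

end

theory Submission
  imports Defs "HOL-Computational_Algebra.Polynomial"
begin

text \<open>
  The closed pointed cone \<open>\<gamma>\<close> is spanned by its extreme rays (Krein--Milman applied to a compact
  slice), so the \<open>v i\<close> form a basis and, by Cramer's rule, the quotient of determinants is the
  coordinate \<open>\<rho>\<close> of \<open>b\<close> along \<open>v k\<close>.

  An external column \<open>a\<close> of \<open>\<gamma>\<close> does not lie in the closed cone \<open>C\<close> generated by the other columns,
  so \<open>C\<close> misses a nonempty open subcone \<open>U\<close> of \<open>\<gamma>\<close>. Every representation of a lattice point of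
  \<open>U\<close> uses \<open>a\<close>, hence \<open>p\<^sub>A(b) = p\<^sub>A(b - a)\<close> there. A quasi-polynomial identity that holds
  on an open cone holds everywhere, so \<open>P(b) = P(b - a)\<close> for all \<open>b\<close>.

  By saturation, two lattice points with the same \<open>\<rho>\<close> differ by an integral combination of the
  external columns, so \<open>P\<close> restricted to the lattice is a function \<open>h\<close> of \<open>\<rho>\<close>. This \<open>h\<close> inherits
  quasi-polynomiality from \<open>P\<close>, and it is the Ehrhart quasi-polynomial of the internal ray.
\<close>

section \<open>Linearity of the embedding of integer vectors\<close>

lemma real_vec_add: "real_vec (x + y) = real_vec x + real_vec y"
  and real_vec_diff: "real_vec (x - y) = real_vec x - real_vec y"
  and real_vec_zero [simp]: "real_vec 0 = 0"
  and real_vec_smult: "real_vec (c *s x) = real_of_int c *\<^sub>R real_vec x"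
  by (simp_all add: real_vec_def vec_eq_iff)

lemma real_vec_sum: "real_vec (\<Sum>i\<in>S. f i) = (\<Sum>i\<in>S. real_vec (f i))"
  by (induction S rule: infinite_finite_induct) (simp_all add: real_vec_add)

lemma finite_cols [simp]: "finite (cols A s)"
  by (simp add: cols_def)

subsection \<open>Finitely generated cones\<close>

lemma convex_cone_pos: "convex_cone (pos S)"
  unfolding convex_cone_iff
proof (intro conjI ballI allI impI)
  show "0 \<in> pos S"
    unfolding pos_def by (auto intro!: exI[of _ "\<lambda>_. 0"])
next
  fix x y assume "x \<in> pos S" "y \<in> pos S"
  then obtain c d where "x = (\<Sum>v\<in>S. c v *\<^sub>R real_vec v)" "\<forall>v\<in>S. 0 \<le> c v"
    "y = (\<Sum>v\<in>S. d v *\<^sub>R real_vec v)" "\<forall>v\<in>S. 0 \<le> d v"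
    unfolding pos_def by blast
  then show "x + y \<in> pos S"
    unfolding pos_def
    by (intro CollectI exI[of _ "\<lambda>v. c v + d v"]) (auto simp: scaleR_add_left sum.distrib)
next
  fix x and r :: real assume "x \<in> pos S" "0 \<le> r"
  then obtain c where "x = (\<Sum>v\<in>S. c v *\<^sub>R real_vec v)" "\<forall>v\<in>S. 0 \<le> c v"
    unfolding pos_def by blast
  with \<open>0 \<le> r\<close> show "r *\<^sub>R x \<in> pos S"
    unfolding pos_def
    by (intro CollectI exI[of _ "\<lambda>v. r * c v"]) (auto simp: scaleR_sum_right)
qed

lemma real_vec_in_pos:
  assumes "finite S" "v \<in> S"
  shows "real_vec v \<in> pos S"
proof -
  have "real_vec v = (\<Sum>u\<in>S. (if u = v then 1 else 0) *\<^sub>R real_vec u)"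
    using assms by (simp add: if_distrib[of "\<lambda>c. c *\<^sub>R _"] cong: if_cong)
  then show ?thesis
    unfolding pos_def by (intro CollectI exI[of _ "\<lambda>u. if u = v then 1 else 0"]) auto
qed

lemma convex_cone_sum:
  assumes "convex_cone C" "\<And>i. i \<in> S \<Longrightarrow> f i \<in> C"
  shows "(\<Sum>i\<in>S. f i) \<in> C"
  using assms(2)
  by (induction S rule: infinite_finite_induct)
    (auto simp: convex_cone_contains_0[OF assms(1)] intro: convex_cone_add[OF assms(1)])

text \<open>In this form closedness of finitely generated cones becomes available, and later the
  description of their slices.\<close>

lemma pos_eq_convex_cone_hull:
  assumes "finite S"
  shows "pos S = convex_cone hull (real_vec ` S)"
proof
  show "pos S \<subseteq> convex_cone hull (real_vec ` S)"
    unfolding pos_def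
    by (auto intro!: convex_cone_sum[OF convex_cone_convex_cone_hull] convex_cone_hull_mul
        intro: hull_inc)
  show "convex_cone hull (real_vec ` S) \<subseteq> pos S"
    using assms by (intro hull_minimal convex_cone_pos) (auto intro: real_vec_in_pos)
qed

lemma closed_pos: "finite S \<Longrightarrow> closed (pos S)"
  by (simp add: pos_eq_convex_cone_hull closed_convex_cone_hull)

lemma pos_subset_span: "pos S \<subseteq> span (real_vec ` S)"
  unfolding pos_def by (auto intro!: span_sum span_scale intro: span_base)

lemma pos_singleton: "pos {v} = {c *\<^sub>R real_vec v | c. 0 \<le> c}"
  unfolding pos_def by (auto intro: exI[of _ "\<lambda>_. _"])

section \<open>Slices and extreme rays of pointed cones\<close>

text \<open>A nonzero element of the cone is \<open>c *\<^sub>R y\<close> with \<open>y\<close> in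
  the convex hull, where \<open>f\<close> is 1, so \<open>c = f x\<close> is positive. Later this
  makes a slice of a chamber bounded.\<close>

lemma convex_cone_hull_slice:
  fixes B :: "'a::euclidean_space set"
  assumes "finite B" "linear f" "\<And>b. b \<in> B \<Longrightarrow> f b = (1::real)"
  shows "convex_cone hull B \<inter> {x. f x = 1} \<subseteq> convex hull B"
    and "x \<in> convex_cone hull B \<Longrightarrow> x \<noteq> 0 \<Longrightarrow> 0 < f x"
proof -
  have *: "x = 0 \<or> (f x > 0 \<and> x /\<^sub>R f x \<in> convex hull B)" if "x \<in> convex_cone hull B" for x
  proof (cases "x = 0")
    case False
    have "x \<in> insert 0 (conic hull (convex hull B))"
      using that convex_cone_hull_separate[of B] by simp
    then obtain c y where x: "x = c *\<^sub>R y" "0 \<le> c" "y \<in> convex hull B"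
      using False by (auto simp: conic_hull_explicit)
    have "convex hull B \<subseteq> {z. f z = 1}"
      using assms by (intro hull_minimal) (auto simp: convex_def linear_add linear_scale)
    then have "f y = 1"
      using x by auto
    then have "f x = c" "c > 0"
      using x False assms(2) by (auto simp: linear_scale intro: order_neq_le_trans)
    then show ?thesis using x by simp
  qed simp
  show "convex_cone hull B \<inter> {x. f x = 1} \<subseteq> convex hull B"
    using * linear_0[OF assms(2)] by fastforce
  show "x \<in> convex_cone hull B \<Longrightarrow> x \<noteq> 0 \<Longrightarrow> 0 < f x"
    using * by blast
qed

text \<open>Rescaling the ends of a segment that crosses the ray to height 1 under \<open>f\<close>
  gives a segment of the slice through \<open>p\<close>. Extremality collapses it to
  \<open>p\<close>, so both ends are multiples of \<open>p\<close>.\<close>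

lemma ray_of_extreme_point_of_slice:
  fixes C :: "(real^'d) set"
  assumes C: "convex_cone C" and f: "linear f" "\<And>x. x \<in> C \<Longrightarrow> x \<noteq> 0 \<Longrightarrow> 0 < f x"
    and p: "p extreme_point_of (C \<inter> {x. f x = (1::real)})"
  shows "ray_of {c *\<^sub>R p | c. 0 \<le> c} C"
  unfolding ray_of_def
proof
  let ?R = "{c *\<^sub>R p | c. 0 \<le> c}"
  have pC: "p \<in> C" "f p = 1"
    using p by (auto simp: extreme_point_of_def)
  have p0: "p \<noteq> 0"
    using pC linear_0[OF f(1)] by auto
  have f0: "0 \<le> f x" if "x \<in> C" for x
    using f(2)[OF that] linear_0[OF f(1)] by (cases "x = 0") auto
  have RI: "x \<in> ?R" if "x /\<^sub>R f x = p" "0 < f x" for x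
  proof -
    have "x = f x *\<^sub>R p"
      using that by auto
    then show ?thesis
      using that(2) by (metis (mono_tags, lifting) less_imp_le mem_Collect_eq)
  qed
  show "?R face_of C"
    unfolding face_of_def
  proof (intro conjI ballI impI)
    show "?R \<subseteq> C"
      using pC C by (auto intro: convex_cone_scaleR)
    have "?R = (\<lambda>c. c *\<^sub>R p) ` {0..}"
      by auto
    then show "convex ?R"
      by (simp add: convex_linear_image linear_scaleR_left)
  next
    fix a b x assume ab: "a \<in> C" "b \<in> C" and x: "x \<in> ?R" "x \<in> open_segment a b"
    obtain c where c: "x = c *\<^sub>R p" "0 \<le> c"
      using x by auto
    obtain u where u: "0 < u" "u < 1" "a \<noteq> b" "x = (1 - u) *\<^sub>R a + u *\<^sub>R b"
      using x by (auto simp: in_segment)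
    have fx: "f x = (1 - u) * f a + u * f b"
      unfolding u(4) using f(1) by (simp add: linear_add linear_scale)
    have "f x = c"
      unfolding c(1) using pC f(1) by (simp add: linear_scale)
    note fx = fx this
    have fab: "0 \<le> f a" "0 \<le> f b"
      using f0 ab by auto
    \<comment> \<open>At height 0 both ends would be 0, although an open segment that contains a
      point has distinct ends.\<close>
    have "c \<noteq> 0"
    proof
      assume "c = 0"
      then have "f a = 0" "f b = 0"
        using fx fab u by (auto simp: add_nonneg_eq_0_iff)
      then show False
        using f(2) ab u by (metis less_irrefl)
    qed
    then have "0 < c" using c by simp
    have p_eq: "p = ((1 - u) / c) *\<^sub>R a + (u / c) *\<^sub>R b"
    proof -
      have "p = (1 / c) *\<^sub>R x"
        using c \<open>c \<noteq> 0\<close> by simp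
      then show ?thesis
        unfolding u(4) by (simp add: scaleR_add_right)
    qed
    \<comment> \<open>A zero end cannot be rescaled to height 1, but then the other end is visibly a
      multiple of \<open>p\<close>.\<close>
    consider "a = 0" | "b = 0" | "a \<noteq> 0" "b \<noteq> 0" by blast
    then have "a \<in> ?R \<and> b \<in> ?R"
    proof cases
      case 1
      then have "u *\<^sub>R b = c *\<^sub>R p"
        using u c by simp
      then have "b = (c / u) *\<^sub>R p"
        using u by (simp add: vec_eq_iff field_simps)
      then show ?thesis
        using 1 u c by (auto intro: exI[of _ "c / u"] exI[of _ 0])
    next
      case 2
      then have "(1 - u) *\<^sub>R a = c *\<^sub>R p"
        using u c by simp
      then have "a = (c / (1 - u)) *\<^sub>R p"
        using u by (simp add: vec_eq_iff field_simps)
      then show ?thesis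
        using 2 u c by (auto intro: exI[of _ "c / (1 - u)"] exI[of _ 0])
    next
      case 3
      then have fpos: "0 < f a" "0 < f b"
        using f(2) ab by auto
      define a' b' where "a' = a /\<^sub>R f a" and "b' = b /\<^sub>R f b"
      have mem: "a' \<in> C \<inter> {x. f x = 1}" "b' \<in> C \<inter> {x. f x = 1}"
        using fpos ab C f(1) by (auto simp: a'_def b'_def linear_scale intro: convex_cone_scaleR)
      \<comment> \<open>The weight of \<open>b'\<close> after rescaling; by \<open>fx\<close> the
        two new weights sum to 1.\<close>
      define w where "w = u * f b / c"
      have w: "0 < w" "1 - w = (1 - u) * f a / c"
        using u fpos \<open>0 < c\<close> fx by (auto simp: w_def field_simps)
      then have "0 < 1 - w"
        using u fpos \<open>0 < c\<close> by simp
      have pw: "p = (1 - w) *\<^sub>R a' + w *\<^sub>R b'"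
        unfolding w(2) unfolding w_def a'_def b'_def p_eq
        using fpos by (simp add: mult.assoc)
      have "p \<in> open_segment a' b'" if "a' \<noteq> b'"
        using that w(1) \<open>0 < 1 - w\<close> pw by (auto simp: in_segment)
      then have "a' = b'"
        using p mem by (auto simp: extreme_point_of_def)
      with pw have "a' = p" "b' = p"
        by (auto simp: scaleR_add_left[symmetric])
      then show ?thesis
        using RI fpos by (simp add: a'_def b'_def)
    qed
    then show "a \<in> ?R" "b \<in> ?R" by auto
  qed
  \<comment> \<open>The ray lies between \<open>{0, p}\<close> and the line through them, both of
    affine dimension 1.\<close>
  have "aff_dim {0, p} \<le> aff_dim ?R"
    by (rule aff_dim_subset) (auto intro: exI[of _ 0] exI[of _ 1])
  moreover have "aff_dim ?R \<le> aff_dim (span {p})"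
    by (rule aff_dim_subset) (auto intro: span_scale span_base)
  ultimately show "aff_dim ?R = 1"
    using p0 by (simp add: aff_dim_2 aff_dim_subspace)
qed

text \<open>Extreme points of the compact slice lie on extreme rays. Only the linear span is
  recorded, because the later use is a dimension count.\<close>

lemma closed_cone_subset_span_rays:
  fixes C :: "(real^'d) set"
  assumes C: "convex_cone C" "closed C"
    and f: "linear f" "\<And>x. x \<in> C \<Longrightarrow> x \<noteq> 0 \<Longrightarrow> 0 < f x"
    and bounded: "bounded (C \<inter> {x. f x = (1::real)})"
  shows "C \<subseteq> span (\<Union> {R. ray_of R C})"
proof
  fix x assume x: "x \<in> C"
  let ?K = "C \<inter> {x. f x = 1}" and ?U = "span (\<Union> {R. ray_of R C})"
  show "x \<in> ?U"
  proof (cases "x = 0")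
    case False
    have cont: "continuous_on UNIV f"
      using f(1) by (simp add: linear_continuous_on linear_conv_bounded_linear)
    have "closed {x. f x = 1}"
      using closed_Collect_eq[OF cont continuous_on_const] by simp
    then have "compact ?K"
      using bounded C by (simp add: compact_eq_bounded_closed closed_Int)
    moreover have "convex {x. f x = 1}"
      using f(1) by (auto simp: convex_def linear_add linear_scale)
    then have "convex ?K"
      using C by (auto simp: convex_cone_def intro: convex_Int)
    ultimately have K: "?K = convex hull {p. p extreme_point_of ?K}"
      by (rule Krein_Milman_Minkowski)
    have "{p. p extreme_point_of ?K} \<subseteq> ?U"
    proof safe
      fix p assume "p extreme_point_of ?K"
      then have "ray_of {c *\<^sub>R p | c. 0 \<le> c} C"
        using C(1) f by (intro ray_of_extreme_point_of_slice[where f = f]) auto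
      moreover have "p \<in> {c *\<^sub>R p | c. 0 \<le> c}"
        by (auto intro: exI[of _ 1])
      ultimately show "p \<in> ?U"
        by (intro span_base) blast
    qed
    then have KU: "?K \<subseteq> ?U"
      by (subst K) (auto simp: hull_minimal subspace_imp_convex)
    have "x /\<^sub>R f x \<in> ?K"
      using f(2)[OF x False] f(1) x C by (auto simp: linear_scale intro: convex_cone_scaleR)
    then have "x /\<^sub>R f x \<in> ?U"
      using KU by blast
    from span_scale[OF this, of "f x"] show ?thesis
      using f(2)[OF x False] by simp
  qed (simp add: span_zero)
qed

subsection \<open>Quasi-polynomials along lattice lines\<close>

text \<open>The bound \<open>M\<close> is chosen before the line: a quasi-polynomial in one variable
  needs a single degree bound for all its residue classes.\<close>

lemma real_polynomial_function_on_line: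
  assumes "real_polynomial_function q"
  shows "\<exists>M. \<forall>x y. \<exists>p :: real poly. degree p \<le> M \<and> (\<forall>s. q (x + s *\<^sub>R y) = poly p s)"
  using assms
proof (induction rule: real_polynomial_function.induct)
  case (linear f)
  then have "linear f"
    by (rule bounded_linear.linear)
  then have "f (x + s *\<^sub>R y) = poly [:f x, f y:] s" for x y s
    by (simp add: linear_add linear_scale)
  moreover have "degree [:f x, f y:] \<le> 1" for x y
    by simp
  ultimately show ?case by blast
next
  case (const c)
  have "c = poly [:c:] s" "degree [:c:] \<le> 0" for s
    by simp_all
  then show ?case by blast
next
  case (add f g)
  then obtain M M' where
    M: "\<forall>x y. \<exists>p :: real poly. degree p \<le> M \<and> (\<forall>s. f (x + s *\<^sub>R y) = poly p s)" and
    M': "\<forall>x y. \<exists>p :: real poly. degree p \<le> M' \<and> (\<forall>s. g (x + s *\<^sub>R y) = poly p s)"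
    by blast
  show ?case
  proof (intro exI[of _ "max M M'"] allI)
    fix x y
    obtain p p' where "degree p \<le> M" "\<forall>s. f (x + s *\<^sub>R y) = poly p s"
      "degree p' \<le> M'" "\<forall>s. g (x + s *\<^sub>R y) = poly p' s"
      using M M' by meson
    then show "\<exists>p. degree p \<le> max M M' \<and>
        (\<forall>s. f (x + s *\<^sub>R y) + g (x + s *\<^sub>R y) = poly p s)"
      by (intro exI[of _ "p + p'"]) (auto intro: degree_add_le)
  qed
next
  case (mult f g)
  then obtain M M' where
    M: "\<forall>x y. \<exists>p :: real poly. degree p \<le> M \<and> (\<forall>s. f (x + s *\<^sub>R y) = poly p s)" and
    M': "\<forall>x y. \<exists>p :: real poly. degree p \<le> M' \<and> (\<forall>s. g (x + s *\<^sub>R y) = poly p s)"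
    by blast
  show ?case
  proof (intro exI[of _ "M + M'"] allI)
    fix x y
    obtain p p' where "degree p \<le> M" "\<forall>s. f (x + s *\<^sub>R y) = poly p s"
      "degree p' \<le> M'" "\<forall>s. g (x + s *\<^sub>R y) = poly p' s"
      using M M' by meson
    then show "\<exists>p. degree p \<le> M + M' \<and>
        (\<forall>s. f (x + s *\<^sub>R y) * g (x + s *\<^sub>R y) = poly p s)"
      by (intro exI[of _ "p * p'"]) (auto intro: degree_mult_le[THEN order_trans])
  qed
qed

text \<open>Residue vectors form a finite set, so degree bounds can be maximised over them.\<close>

lemma finite_bounded_int_vectors: "finite {r :: int^'d. \<forall>i. 0 \<le> r $ i \<and> r $ i < n}"
proof (rule finite_subset)
  show "{r :: int^'d. \<forall>i. 0 \<le> r $ i \<and> r $ i < n}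
      \<subseteq> (\<lambda>f. \<chi> i. f i) ` (Pi\<^sub>E UNIV (\<lambda>_. {0..<n}))"
  proof
    fix r :: "int^'d" assume "r \<in> {r. \<forall>i. 0 \<le> r $ i \<and> r $ i < n}"
    then show "r \<in> (\<lambda>f. \<chi> i. f i) ` (Pi\<^sub>E UNIV (\<lambda>_. {0..<n}))"
      by (intro image_eqI[of _ _ "\<lambda>i. r $ i"]) auto
  qed
qed (intro finite_imageI finite_PiE, auto)

text \<open>Steps by multiples of \<open>N\<close> stay in one residue class, where \<open>P\<close>
  is a single polynomial; \<open>M\<close> is the largest degree bound over all classes.\<close>

lemma quasi_polynomial_on_lines:
  fixes P :: "int^'d \<Rightarrow> real"
  assumes "quasi_polynomial P"
  obtains N M where "N > 0" and
    "\<And>b w. \<exists>p. degree p \<le> M \<and>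
      (\<forall>m. P (b + (m * int N) *s w) = poly p (real_of_int m))"
proof -
  obtain N where N: "N > 0" and ex: "\<forall>r. \<exists>q. real_polynomial_function q \<and>
      (\<forall>b. (\<forall>i. b $ i mod int N = r $ i mod int N) \<longrightarrow> P b = q (real_vec b))"
    using assms unfolding quasi_polynomial_def by blast
  then obtain q where q: "\<And>r. real_polynomial_function (q r)"
    and Pq: "\<And>r b. (\<forall>i. b $ i mod int N = r $ i mod int N) \<Longrightarrow> P b = q r (real_vec b)"
    by metis
  obtain deg where deg: "\<And>r x y. \<exists>p :: real poly. degree p \<le> deg r \<and>
      (\<forall>s. q r (x + s *\<^sub>R y) = poly p s)"
    using real_polynomial_function_on_line[OF q] by metis
  define R where "R = {r :: int^'d. \<forall>i. 0 \<le> r $ i \<and> r $ i < int N}"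
  have R: "finite R"
    unfolding R_def by (rule finite_bounded_int_vectors)
  show thesis
  proof (rule that[OF N, of "Max (deg ` R)"])
    fix b w :: "int^'d"
    define r where "r = (\<chi> i. b $ i mod int N)"
    have "r \<in> R"
      using N by (simp add: r_def R_def)
    then have degr: "deg r \<le> Max (deg ` R)"
      using R by simp
    obtain p where p: "degree p \<le> deg r"
      "\<And>s. q r (real_vec b + s *\<^sub>R (real N *\<^sub>R real_vec w)) = poly p s"
      using deg by meson
    have "P (b + (m * int N) *s w) = poly p (real_of_int m)" for m
    proof -
      have "P (b + (m * int N) *s w) = q r (real_vec (b + (m * int N) *s w))"
        by (rule Pq) (simp add: r_def mult.assoc mult.left_commute[of m])
      also have "\<dots> = poly p (real_of_int m)"
        using p(2)[of "real_of_int m"] by (simp add: real_vec_add real_vec_smult)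
      finally show ?thesis .
    qed
    then show "\<exists>p. degree p \<le> Max (deg ` R) \<and>
      (\<forall>m. P (b + (m * int N) *s w) = poly p (real_of_int m))"
      using p(1) degr by (intro exI[of _ p]) auto
  qed
qed

section \<open>Open cones and invariance under translation\<close>

text \<open>Rounding \<open>n\<close> times \<open>g\<close> down and dividing by \<open>n\<close>
  approximates \<open>g\<close>, hence lands in \<open>U\<close> for large \<open>n\<close>; scaling
  back restores integrality.\<close>

lemma integral_point_in_open_cone:
  fixes U :: "(real^'d) set"
  assumes "open U" "U \<noteq> {}" and cone: "\<And>c x. 0 < c \<Longrightarrow> x \<in> U \<Longrightarrow> c *\<^sub>R x \<in> U"
  obtains y where "real_vec y \<in> U"
proof -
  obtain g where "g \<in> U" using assms by blast
  define y where "y n = (\<chi> i. \<lfloor>real n * g $ i\<rfloor>)" for n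
  have "(\<lambda>n. (1 / real n) *\<^sub>R real_vec (y n)) \<longlonglongrightarrow> g"
  proof (rule vec_tendstoI)
    fix i
    have "(\<lambda>n. real_of_int \<lfloor>real n * g $ i\<rfloor> / real n) \<longlonglongrightarrow> g $ i"
    proof (rule tendsto_sandwich)
      show "(\<lambda>n. g $ i - inverse (real n)) \<longlonglongrightarrow> g $ i"
        using tendsto_diff[OF tendsto_const lim_inverse_n, of "g $ i"] by simp
      show "\<forall>\<^sub>F n in sequentially. g $ i - inverse (real n) \<le> real_of_int \<lfloor>real n * g $ i\<rfloor> / real n"
        using eventually_gt_at_top[of 0]
      proof eventually_elim
        case (elim n)
        have "real n * g $ i - 1 \<le> real_of_int \<lfloor>real n * g $ i\<rfloor>"
          by linarith
        then show ?case
          using elim by (simp add: pos_le_divide_eq left_diff_distrib mult.commute[of "real n"])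
      qed
      show "\<forall>\<^sub>F n in sequentially. real_of_int \<lfloor>real n * g $ i\<rfloor> / real n \<le> g $ i"
        using eventually_gt_at_top[of 0]
      proof eventually_elim
        case (elim n)
        have "real_of_int \<lfloor>real n * g $ i\<rfloor> \<le> real n * g $ i"
          by linarith
        then show ?case
          using elim by (simp add: field_simps)
      qed
    qed simp
    then show "(\<lambda>n. ((1 / real n) *\<^sub>R real_vec (y n)) $ i) \<longlonglongrightarrow> g $ i"
      by (simp add: y_def real_vec_def)
  qed
  then have "\<forall>\<^sub>F n in sequentially. (1 / real n) *\<^sub>R real_vec (y n) \<in> U"
    using \<open>open U\<close> \<open>g \<in> U\<close> by (rule topological_tendstoD)
  then have "\<forall>\<^sub>F n in sequentially. n > 0 \<and> (1 / real n) *\<^sub>R real_vec (y n) \<in> U"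
    using eventually_gt_at_top[of 0] by (simp add: eventually_conj)
  then obtain n where n: "n > 0" "(1 / real n) *\<^sub>R real_vec (y n) \<in> U"
    using eventually_happens' sequentially_bot by blast
  then have "real_vec (y n) \<in> U"
    using cone[of "real n" "(1 / real n) *\<^sub>R real_vec (y n)"] by simp
  then show thesis by (rule that)
qed

text \<open>After division by \<open>m\<close> the points tend to \<open>y\<close>; the cone
  property undoes the division.\<close>

lemma translate_eventually_in_open_cone:
  fixes U :: "(real^'d) set"
  assumes "open U" and cone: "\<And>c x. 0 < c \<Longrightarrow> x \<in> U \<Longrightarrow> c *\<^sub>R x \<in> U" and "y \<in> U"
  shows "\<forall>\<^sub>F m in sequentially. x + real m *\<^sub>R y \<in> U"
proof -
  have "(\<lambda>m. inverse (real m) *\<^sub>R x + y) \<longlonglongrightarrow> 0 *\<^sub>R x + y"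
    by (intro tendsto_intros lim_inverse_n)
  then have "\<forall>\<^sub>F m in sequentially. inverse (real m) *\<^sub>R x + y \<in> U"
    using assms by (intro topological_tendstoD[of _ y]) auto
  then show ?thesis
    using eventually_gt_at_top[of 0]
  proof eventually_elim
    case (elim m)
    then show ?case
      using cone[of "real m" "inverse (real m) *\<^sub>R x + y"] by (simp add: scaleR_add_right)
  qed
qed

text \<open>From any start, walking far in an integral direction taken from \<open>U\<close> leads
  into \<open>U\<close>. The polynomials describing \<open>P\<close> on the parallel lines through
  \<open>b\<close> and \<open>b - a\<close> thus agree at all large integers, so they are equal, and
  parameter 0 gives the claim.\<close>

lemma quasi_polynomial_invariant_translation:
  assumes P: "quasi_polynomial P"
    and U: "open U" "U \<noteq> {}" and cone: "\<And>c x. 0 < c \<Longrightarrow> x \<in> U \<Longrightarrow> c *\<^sub>R x \<in> U"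
    and eq: "\<And>b. real_vec b \<in> U \<Longrightarrow> real_vec (b - a) \<in> U \<Longrightarrow> P b = P (b - a)"
  shows "P b = P (b - a)"
proof -
  obtain N M where N: "N > 0" and line: "\<And>b w. \<exists>p. degree p \<le> M \<and>
      (\<forall>m. P (b + (m * int N) *s w) = poly p (real_of_int m))"
    using quasi_polynomial_on_lines[OF P] by metis
  obtain y where y: "real_vec y \<in> U"
    by (rule integral_point_in_open_cone[OF U]) (use cone in auto)
  obtain p p' where p: "\<And>m. P (b + (m * int N) *s y) = poly p (real_of_int m)"
    and p': "\<And>m. P (b - a + (m * int N) *s y) = poly p' (real_of_int m)"
    using line by meson
  have yN: "real N *\<^sub>R real_vec y \<in> U"
    using cone y N by simp
  have ev: "\<forall>\<^sub>F m in sequentially. x + real m *\<^sub>R (real N *\<^sub>R real_vec y) \<in> U" for x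
    by (rule translate_eventually_in_open_cone[OF U(1) _ yN]) (rule cone)
  have "\<forall>\<^sub>F m in sequentially. poly (p - p') (real m) = 0"
    using ev[of "real_vec b"] ev[of "real_vec (b - a)"]
  proof eventually_elim
    case (elim m)
    have shift: "b + (int m * int N) *s y - a = b - a + (int m * int N) *s y"
      by simp
    have "P (b + (int m * int N) *s y) = P (b + (int m * int N) *s y - a)"
      by (rule eq, unfold shift) (use elim in \<open>simp_all add: real_vec_add real_vec_smult\<close>)
    then show ?case
      unfolding shift using p[of "int m"] p'[of "int m"] by simp
  qed
  then obtain m0 where "\<And>m. m \<ge> m0 \<Longrightarrow> poly (p - p') (real m) = 0"
    unfolding eventually_sequentially by blast
  then have "real ` {m0..} \<subseteq> {x. poly (p - p') x = 0}"
    by auto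
  moreover have "infinite (real ` {m0..})"
    by (simp add: finite_image_iff infinite_Ici)
  ultimately have "p - p' = 0"
    using poly_roots_finite finite_subset by blast
  then show ?thesis
    using p[of 0] p'[of 0] by simp
qed

section \<open>Descent to one variable\<close>

lemma poly_eq_sum_atMost:
  fixes x :: "'a::comm_semiring_1"
  assumes "degree p \<le> M"
  shows "poly p x = (\<Sum>i\<le>M. coeff p i * x ^ i)"
proof -
  have "(\<Sum>i\<le>degree p. coeff p i * x ^ i) = (\<Sum>i\<le>M. coeff p i * x ^ i)"
    using assms by (intro sum.mono_neutral_left) (auto simp: coeff_eq_0)
  then show ?thesis
    by (simp add: poly_altdef)
qed

text \<open>On \<open>L\<close> the value of \<open>P\<close> depends only on \<rho>, and adding
  \<open>N\<close> times \<open>w\<close> raises \<rho> by \<open>N * n\<close>. So \<open>h\<close>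
  is one polynomial on each class of parameters modulo \<open>N * n\<close>, which is an integer
  period because \<open>n\<close> is an integer.\<close>

lemma quasi_polynomial_descends:
  fixes P :: "int^'d \<Rightarrow> real" and \<rho> :: "real^'d \<Rightarrow> real"
  assumes P: "quasi_polynomial P" and \<rho>: "linear \<rho>"
    and L: "\<And>b w m. b \<in> L \<Longrightarrow> w \<in> L \<Longrightarrow> b + m *s w \<in> L"
    and inv: "\<And>b b'. b \<in> L \<Longrightarrow> b' \<in> L \<Longrightarrow> \<rho> (real_vec b) = \<rho> (real_vec b') \<Longrightarrow> P b = P b'"
    and w: "w \<in> L" "\<rho> (real_vec w) = real n" "n > 0"
  obtains h where "quasi_polynomial_1 h" "\<And>b. b \<in> L \<Longrightarrow> h (\<rho> (real_vec b)) = P b"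
proof -
  obtain N M where N: "N > 0" and line: "\<And>b w. \<exists>p. degree p \<le> M \<and>
      (\<forall>m. P (b + (m * int N) *s w) = poly p (real_of_int m))"
    using quasi_polynomial_on_lines[OF P] by metis
  define T where "T = (\<lambda>b. \<rho> (real_vec b)) ` L"
  define g where "g t = (SOME b. b \<in> L \<and> \<rho> (real_vec b) = t)" for t
  have g: "g t \<in> L" "\<rho> (real_vec (g t)) = t" if "t \<in> T" for t
  proof -
    have "\<exists>b. b \<in> L \<and> \<rho> (real_vec b) = t"
      using that by (auto simp: T_def)
    then have "g t \<in> L \<and> \<rho> (real_vec (g t)) = t"
      unfolding g_def by (rule someI_ex)
    then show "g t \<in> L" "\<rho> (real_vec (g t)) = t"
      by auto
  qed
  have "\<forall>t. \<exists>p. degree p \<le> M \<and>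
      (\<forall>m. P (g t + (m * int N) *s w) = poly p (real_of_int m))"
    using line by blast
  then obtain p where p: "\<And>t. degree (p t) \<le> M"
    "\<And>t m. P (g t + (m * int N) *s w) = poly (p t) (real_of_int m)"
    by metis
  define q where "q = real (N * n)"
  have q: "q > 0"
    using N w by (simp add: q_def)
  \<comment> \<open>The representative of \<open>t\<close> modulo \<open>q\<close> in the interval
    from 0 to \<open>q\<close>.\<close>
  define fl where "fl t = t - q * real_of_int \<lfloor>t / q\<rfloor>" for t
  have fl_period: "fl (t + q) = fl t" for t
    using q by (simp add: fl_def add_divide_distrib algebra_simps)
  \<comment> \<open>Parameters without a lattice point get the value 0. This fits periodic
    coefficients, since \<open>T\<close> is stable under shifts by multiples of
    \<open>q\<close>.\<close>
  define h where "h t = (if t \<in> T then P (g t) else 0)" for t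
  \<comment> \<open>Position \<open>s\<close> in the class of \<open>t\<close> is reached after
    \<open>(s - t) / q\<close> steps; this substitution turns a polynomial in the number of steps
    into one in the position.\<close>
  define r where "r t = pcompose (p t) [:- t / q, 1 / q:]" for t
  define c where "c i t = (if fl t \<in> T then coeff (r (fl t)) i else 0)" for i t
  have hP: "h (\<rho> (real_vec b)) = P b" if "b \<in> L" for b
  proof -
    have "\<rho> (real_vec b) \<in> T"
      using that by (simp add: T_def)
    with g[OF this] inv[OF _ that] show ?thesis
      by (simp add: h_def)
  qed
  have \<rho>_shift: "\<rho> (real_vec (b + (m * int N) *s w)) = \<rho> (real_vec b) + q * real_of_int m" for b m
    using \<rho> w by (simp add: real_vec_add real_vec_smult linear_add linear_scale q_def)
  have T_shift: "t + q * real_of_int m \<in> T" if t: "t \<in> T" for t m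
  proof -
    obtain b where b: "b \<in> L" "t = \<rho> (real_vec b)"
      using t by (auto simp: T_def)
    then show ?thesis
      using L[OF b(1) w(1), of "m * int N"] \<rho>_shift[of b m] unfolding T_def by (metis imageI)
  qed
  have "quasi_polynomial_1 h"
    unfolding quasi_polynomial_1_def
  proof (intro exI conjI allI)
    show "0 < N * n" using N w by simp
    show "c i (t + real (N * n)) = c i t" for i t
      using fl_period[of t] by (simp add: c_def q_def)
    fix t
    define m where "m = \<lfloor>t / q\<rfloor>"
    have t: "t = fl t + q * real_of_int m"
      by (simp add: fl_def m_def)
    show "h t = (\<Sum>i\<le>M. c i t * t ^ i)"
    proof (cases "fl t \<in> T")
      case True
      have "h t = P (g (fl t) + (m * int N) *s w)"
        using hP[OF L[OF g(1)[OF True] w(1)], of "m * int N"] g(2)[OF True] t[symmetric]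
        by (simp add: \<rho>_shift)
      also have "\<dots> = poly (r (fl t)) t"
      proof -
        have "real_of_int m = - fl t / q + t * (1 / q)"
          using q t by (simp add: field_simps)
        then show ?thesis
          by (simp add: p(2) r_def poly_pcompose)
      qed
      also have "\<dots> = (\<Sum>i\<le>M. c i t * t ^ i)"
      proof -
        have "degree (r (fl t)) \<le> M"
          using p(1)[of "fl t"] q by (simp add: r_def degree_pcompose)
        then show ?thesis
          using True by (simp add: poly_eq_sum_atMost c_def)
      qed
      finally show ?thesis .
    next
      case False
      \<comment> \<open>Otherwise shifting back by \<open>m\<close> periods would put
        \<open>fl t\<close> into \<open>T\<close>.\<close>
      then have "t \<notin> T"
        using T_shift[of t "- m"] by (auto simp: fl_def m_def)
      then show ?thesis
        using False by (simp add: h_def c_def)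
    qed
  qed
  then show thesis
    using hP that by blast
qed

subsection \<open>Lattices, semigroups and the partition function\<close>

text \<open>This single closure property yields sums, differences and integer multiples.\<close>

lemma lattice_gen_add_smult:
  assumes "b \<in> lattice_gen S" "w \<in> lattice_gen S"
  shows "b + m *s w \<in> lattice_gen S"
proof -
  obtain c d where "b = (\<Sum>v\<in>S. c v *s v)" "w = (\<Sum>v\<in>S. d v *s v)"
    using assms unfolding lattice_gen_def by blast
  then have "b + m *s w = (\<Sum>v\<in>S. (c v + m * d v) *s v)"
    by (simp add: vec_eq_iff sum.distrib sum_distrib_left algebra_simps)
  then show ?thesis
    unfolding lattice_gen_def by (auto intro!: exI[of _ "\<lambda>v. c v + m * d v"])
qed

lemma lattice_gen_base:
  assumes "finite S" "v \<in> S"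
  shows "v \<in> lattice_gen S"
proof -
  have "v = (\<Sum>u\<in>S. (if u = v then 1 else 0) *s u)"
    using assms by (simp add: if_distrib[of "\<lambda>c. c *s _"] cong: if_cong)
  then show ?thesis
    unfolding lattice_gen_def by (intro CollectI exI[of _ "\<lambda>u. if u = v then 1 else 0"]) auto
qed

lemma semigroup_gen_subset_lattice_gen: "semigroup_gen S \<subseteq> lattice_gen S"
  unfolding semigroup_gen_def lattice_gen_def
proof safe
  fix c :: "int^'a \<Rightarrow> nat"
  show "\<exists>d. (\<Sum>v\<in>S. int (c v) *s v) = (\<Sum>v\<in>S. d v *s v) \<and> True"
    by (intro exI[of _ "\<lambda>v. int (c v)"]) simp
qed

text \<open>Adding a large multiple of every generator makes the real coefficients nonnegative, so
  saturation applies to the translate. Thus \<open>c\<close> is a difference of two semigroup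
  elements.\<close>

lemma saturated_lattice_Int_span:
  assumes sat: "saturated_in S L" and S: "finite S" "S \<subseteq> L"
    and L: "\<And>b w m. b \<in> L \<Longrightarrow> w \<in> L \<Longrightarrow> b + m *s w \<in> L"
    and c: "c \<in> L" "real_vec c \<in> span (real_vec ` S)"
  obtains m where "c + (\<Sum>u\<in>S. int m *s u) \<in> semigroup_gen S"
proof -
  have inj: "inj_on real_vec S"
    by (auto simp: inj_on_def real_vec_def vec_eq_iff)
  obtain y where y: "real_vec c = (\<Sum>u\<in>S. y u *\<^sub>R real_vec u)"
    using c(2) S(1) unfolding span_finite[OF finite_imageI[OF S(1)]]
    by (auto simp: sum.reindex[OF inj])
  define m where "m = nat \<lceil>\<Sum>u\<in>S. \<bar>y u\<bar>\<rceil>"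
  have m: "- y u \<le> real m" if "u \<in> S" for u
  proof -
    have "\<bar>y u\<bar> \<le> (\<Sum>u\<in>S. \<bar>y u\<bar>)"
      using S that by (intro member_le_sum) auto
    then show ?thesis
      unfolding m_def by linarith
  qed
  have *: "c + (\<Sum>u\<in>T. int m *s u) \<in> L" if "T \<subseteq> S" for T
    using finite_subset[OF that S(1)] that
  proof (induction T rule: finite_induct)
    case (insert x F)
    then have "(c + (\<Sum>u\<in>F. int m *s u)) + int m *s x \<in> L"
      using S(2) L[of "c + (\<Sum>u\<in>F. int m *s u)" x "int m"] by blast
    then show ?case
      using insert by (simp add: algebra_simps)
  qed (simp add: c)
  have "real_vec (c + (\<Sum>u\<in>S. int m *s u)) = (\<Sum>u\<in>S. (y u + real m) *\<^sub>R real_vec u)"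
    by (simp add: real_vec_add real_vec_smult real_vec_sum y scaleR_add_left sum.distrib
        scaleR_sum_right)
  moreover have "\<forall>u\<in>S. 0 \<le> y u + real m"
    using m by force
  ultimately have "real_vec (c + (\<Sum>u\<in>S. int m *s u)) \<in> pos S"
    unfolding pos_def by (intro CollectI exI[of _ "\<lambda>u. y u + real m"] conjI)
  then have "c + (\<Sum>u\<in>S. int m *s u) \<in> semigroup_gen S"
    using sat *[OF order_refl] unfolding saturated_in_def by blast
  then show thesis
    by (rule that)
qed

text \<open>Induction on the multiplicity handles one generator; sums are then built one generator
  at a time.\<close>

lemma invariant_semigroup_gen:
  fixes P :: "int^'d \<Rightarrow> real"
  assumes inv: "\<And>u b. u \<in> S \<Longrightarrow> P (b + u) = P b" and z: "z \<in> semigroup_gen S"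
  shows "P (b + z) = P b"
proof -
  have mult: "P (b + int n *s u) = P b" if "u \<in> S" for n u b
  proof (induction n)
    case (Suc n)
    have "b + int (Suc n) *s u = (b + int n *s u) + u"
      by (simp add: vec_eq_iff algebra_simps)
    then show ?case
      using Suc inv[OF that, of "b + int n *s u"] by metis
  qed simp
  obtain c where "z = (\<Sum>u\<in>S. int (c u) *s u)"
    using z unfolding semigroup_gen_def by blast
  moreover have "P (b + (\<Sum>u\<in>T. int (c u) *s u)) = P b" if "T \<subseteq> S" for T
    using that
  proof (induction T rule: infinite_finite_induct)
    case (insert x F)
    then have "P ((b + (\<Sum>u\<in>F. int (c u) *s u)) + int (c x) *s x) = P b"
      using mult[of x] by simp
    then show ?case
      using insert by (simp add: algebra_simps)
  qed simp_all
  ultimately show ?thesis by simp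
qed

lemma real_vec_column: "real_vec (column j A) = column j (real_mat A)"
  by (simp add: real_vec_def column_def real_mat_def map_matrix_def vec_eq_iff)

text \<open>A solution with coordinate \<open>j\<close> equal to 0 would put \<open>b\<close> into
  the cone of the other columns. So every solution uses column \<open>j\<close>, and removing one
  copy of it is a bijection.\<close>

lemma partition_fun_minus_column:
  fixes A :: "int^'n^'d"
  assumes b: "real_vec b \<notin> pos (cols A (- {j}))"
  shows "partition_fun A b = partition_fun A (b - column j A)"
proof -
  define iv where "iv x = (\<chi> i. int (x $ i))" for x :: "nat^'n"
  have iv_add: "iv (x + axis j 1) = iv x + axis j 1" for x
    by (simp add: iv_def vec_eq_iff axis_def)
  have A_axis: "A *v axis j 1 = column j A"
    by (simp add: matrix_mult_sum axis_def vec_eq_iff if_distrib[of "\<lambda>c. c * _"] cong: if_cong)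
  have "bij_betw (\<lambda>x. x + axis j 1) {x. A *v iv x = b - column j A} {x. A *v iv x = b}"
    unfolding bij_betw_def
  proof (intro conjI equalityI subsetI)
    show "inj_on (\<lambda>x. x + axis j 1) {x. A *v iv x = b - column j A}"
      by (simp add: inj_on_def)
  next
    fix x assume "x \<in> (\<lambda>x. x + axis j 1) ` {x. A *v iv x = b - column j A}"
    then show "x \<in> {x. A *v iv x = b}"
      by (auto simp del: One_nat_def simp: iv_add matrix_vector_right_distrib A_axis)
  next
    fix x assume "x \<in> {x. A *v iv x = b}"
    then have x: "A *v iv x = b" by simp
    have "x $ j \<noteq> 0"
    proof
      assume xj: "x $ j = 0"
      have "real_vec b = (\<Sum>i\<in>UNIV. real (x $ i) *\<^sub>R real_vec (column i A))"
        unfolding x[symmetric] matrix_mult_sum real_vec_sum by (simp add: real_vec_smult iv_def)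
      also have "\<dots> = (\<Sum>i\<in>- {j}. real (x $ i) *\<^sub>R real_vec (column i A))"
        by (rule sum.mono_neutral_right) (auto simp: xj)
      also have "\<dots> \<in> pos (cols A (- {j}))"
        by (intro convex_cone_sum convex_cone_scaleR convex_cone_pos real_vec_in_pos)
          (auto simp: cols_def)
      finally show False using b by simp
    qed
    \<comment> \<open>Subtraction on \<open>nat\<close> truncates; the identity relies on
      \<open>x $ j\<close> being nonzero.\<close>
    then have x_eq: "x = (x - axis j 1) + axis j 1"
      by (auto simp: vec_eq_iff axis_def)
    then have "A *v iv (x - axis j 1) = b - column j A"
      using x iv_add[of "x - axis j 1"] by (simp add: matrix_vector_right_distrib A_axis algebra_simps)
    then show "x \<in> (\<lambda>x. x + axis j 1) ` {x. A *v iv x = b - column j A}"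
      using x_eq by blast
  qed
  then show ?thesis
    unfolding partition_fun_def iv_def by (simp add: bij_betw_same_card)
qed

lemma det_columns_eq_det: "real_of_int (det_columns v) = det (\<chi> i j. real_of_int (v j $ i))"
  unfolding det_columns_def det_def by simp

subsection \<open>External chambers\<close>

text \<open>A proper face has smaller dimension, so a chamber is the whole intersection, and any
  simplicial cone of the family contains it.\<close>

lemma chamber_cone:
  fixes A :: "int^'n^'d"
  assumes \<gamma>: "chamber A \<gamma>" and ray: "ray_of (pos {w}) \<gamma>"
  obtains s where "convex_cone \<gamma>" "closed \<gamma>" "\<gamma> \<subseteq> pos (cols A s)"
    "card s = CARD('d)" "dim (real_vec ` cols A s) = CARD('d)"
proof -
  obtain b where face: "\<gamma> face_of \<Inter>{\<sigma> \<in> simplicial_cones A. b \<in> \<sigma>}" (is "_ face_of ?I")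
    using \<gamma> unfolding chamber_def chamber_complex_def by blast
  have cones: "convex_cone \<sigma> \<and> closed \<sigma>" if "\<sigma> \<in> simplicial_cones A" for \<sigma>
    using that unfolding simplicial_cones_def by (auto intro: convex_cone_pos closed_pos)
  have I: "convex_cone ?I" "closed ?I"
    using cones by (auto intro!: convex_cone_Inter closed_Inter)
  have "\<gamma> = ?I"
  proof (rule ccontr)
    assume "\<gamma> \<noteq> ?I"
    then have "aff_dim \<gamma> < aff_dim ?I"
      using face_of_aff_dim_lt[OF _ face] I by (simp add: convex_cone_def)
    also have "\<dots> \<le> int CARD('d)"
      using aff_dim_le_DIM[of ?I] by simp
    finally show False
      using \<gamma> by (simp add: chamber_def)
  qed
  \<comment> \<open>The empty family would have the whole space as intersection, whose only nonempty
    face is itself; the ray would then be everything.\<close>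
  moreover have "{\<sigma> \<in> simplicial_cones A. b \<in> \<sigma>} \<noteq> {}"
  proof
    assume "{\<sigma> \<in> simplicial_cones A. b \<in> \<sigma>} = {}"
    with \<open>\<gamma> = ?I\<close> have "pos {w} face_of (UNIV :: (real^'d) set)"
      using ray by (simp add: ray_of_def)
    then have "pos {w} = UNIV"
      using face_of_affine_trivial[of UNIV "pos {w}"] convex_cone_nonempty[OF convex_cone_pos]
      by auto
    \<comment> \<open>The first membership forces \<open>real_vec w = 0\<close>, and then the
      nonzero all-ones vector cannot be a multiple of it.\<close>
    then have "- real_vec w \<in> pos {w}" "(\<chi> i. 1) \<in> pos {w}"
      by auto
    then obtain c c' where c: "- real_vec w = c *\<^sub>R real_vec w" "0 \<le> c"
      and c': "(\<chi> i. 1) = c' *\<^sub>R real_vec w"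
      unfolding pos_singleton by auto
    from c(1) have "(1 + c) *\<^sub>R real_vec w = 0"
      by (simp add: scaleR_add_left flip: c(1))
    with c(2) have "real_vec w = 0"
      by simp
    with c' show False
      by (simp add: vec_eq_iff)
  qed
  ultimately show thesis
    using I that unfolding simplicial_cones_def by auto
qed

text \<open>Each ray of \<gamma> is external, hence generated by some \<open>v i\<close> with
  \<open>i \<noteq> k\<close>, or it is the unique internal ray. So \<gamma> lies in the span of the
  \<open>v i\<close>, and its full dimension makes this span everything.\<close>

lemma external_chamber_spanned:
  fixes A :: "int^'n^'d"
  assumes external: "external_chamber A \<gamma>"
    and ext_cols: "external_columns_of A \<gamma> = e ` (- {k})"
    and gens: "\<And>i. i \<noteq> k \<Longrightarrow> pos {v i} = pos {column (e i) A}"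
    and internal: "internal_ray A \<gamma> (pos {v k})"
  shows "span (range (\<lambda>i. real_vec (v i))) = UNIV"
proof -
  let ?V = "range (\<lambda>i. real_vec (v i))"
  have \<gamma>: "chamber A \<gamma>"
    using external by (simp add: external_chamber_def)
  have "ray_of (pos {v k}) \<gamma>"
    using internal by (simp add: internal_ray_def)
  then obtain s where cone: "convex_cone \<gamma>" "closed \<gamma>" and sub: "\<gamma> \<subseteq> pos (cols A s)"
    and s: "card s = CARD('d)" "dim (real_vec ` cols A s) = CARD('d)"
    using chamber_cone[OF \<gamma>] by metis
  define B where "B = real_vec ` cols A s"
  have "finite B" by (simp add: B_def)
  \<comment> \<open>Columns might coincide, so only an upper bound is immediate; together with the
    dimension it gives independence.\<close>
  have "card B \<le> card s"
    unfolding B_def cols_def image_image by (rule card_image_le) simp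
  then have "card B \<le> dim B"
    using s by (simp add: B_def)
  then have "independent B"
    using \<open>finite B\<close> by (intro card_le_dim_spanning[of B B]) (auto intro: span_base)
  \<comment> \<open>The functional that is 1 on all generators of the simplicial cone cuts \<gamma>
    in a bounded slice.\<close>
  then obtain f where f: "linear f" "\<And>x. x \<in> B \<Longrightarrow> f x = (1::real)"
    using linear_independent_extend[of B "\<lambda>_. 1"] by auto
  have posB: "pos (cols A s) = convex_cone hull B"
    by (simp add: pos_eq_convex_cone_hull B_def)
  note slice = convex_cone_hull_slice[OF \<open>finite B\<close> f]
  have "\<gamma> \<inter> {x. f x = 1} \<subseteq> convex hull B"
    using slice(1) sub posB by blast
  then have "bounded (\<gamma> \<inter> {x. f x = 1})"
    using \<open>finite B\<close> by (meson bounded_subset bounded_convex_hull finite_imp_bounded)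
  moreover have "0 < f x" if "x \<in> \<gamma>" "x \<noteq> 0" for x
    using slice(2)[of x] that sub posB by auto
  ultimately have "\<gamma> \<subseteq> span (\<Union>{R. ray_of R \<gamma>})"
    using cone f(1) by (intro closed_cone_subset_span_rays[where f = f])
  also have "\<dots> \<subseteq> span ?V"
  proof (rule span_minimal)
    have pos_V: "pos {v i} \<subseteq> span ?V" for i
      using pos_subset_span[of "{v i}"] span_mono[of "{real_vec (v i)}" ?V] by auto
    have "R \<subseteq> span ?V" if R: "ray_of R \<gamma>" for R
    proof (cases "external_ray A \<gamma> R")
      case True
      then obtain j where "external_column A j" "R = pos {column j A}"
        by (auto simp: external_ray_def)
      with R have "j \<in> e ` (- {k})"
        unfolding ext_cols[symmetric] by (simp add: external_columns_of_def)
      then obtain i where "i \<noteq> k" "j = e i"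
        by auto
      then show ?thesis
        using pos_V[of i] gens[of i] \<open>R = _\<close> by simp
    next
      case False
      with R have "internal_ray A \<gamma> R"
        by (simp add: internal_ray_def)
      then have "R = pos {v k}"
        using external internal by (auto simp: external_chamber_def)
      then show ?thesis
        using pos_V by simp
    qed
    then show "\<Union>{R. ray_of R \<gamma>} \<subseteq> span ?V" by blast
  qed simp
  finally have "aff_dim \<gamma> \<le> aff_dim (span ?V)"
    by (rule aff_dim_subset)
  then have "CARD('d) \<le> dim (span ?V)"
    using \<gamma> by (simp add: chamber_def aff_dim_subspace)
  then show ?thesis
    using dim_eq_full[of ?V] dim_subset_UNIV[of ?V] by simp
qed

text \<open>The invariance holds first on an open cone, where \<open>P\<close> counts solutions that
  all use column \<open>j\<close>, and then spreads to every \<open>b\<close>.\<close>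

lemma chamber_quasi_polynomial_minus_external_column:
  fixes A :: "int^'n^'d"
  assumes P: "chamber_quasi_polynomial A \<gamma> P" and \<gamma>: "chamber A \<gamma>" "convex_cone \<gamma>"
    and j: "j \<in> external_columns_of A \<gamma>"
  shows "P b = P (b - column j A)"
proof -
  define C where "C = pos (cols A (- {j}))"
  have C: "convex_cone C" "closed C"
    by (simp_all add: C_def convex_cone_pos closed_pos)
  have j: "real_vec (column j A) \<notin> C" "ray_of (pos {column j A}) \<gamma>"
    using j by (simp_all add: external_columns_of_def external_column_def C_def)
  then have "real_vec (column j A) \<in> \<gamma>"
    using real_vec_in_pos[of "{column j A}"] by (auto simp: ray_of_def dest: face_of_imp_subset)
  define U where "U = interior \<gamma> - C"
  have "open U"
    using C by (simp add: U_def open_Diff)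
  have "convex \<gamma>"
    using \<gamma> by (simp add: convex_cone_def)
  then have "interior \<gamma> \<noteq> {}"
    using \<gamma> rel_interior_eq_empty[of \<gamma>] interior_rel_interior[of \<gamma>]
    by (simp add: chamber_def convex_cone_nonempty)
  \<comment> \<open>Otherwise \<gamma>, lying in the closure of its interior, would be inside the
    closed cone \<open>C\<close>, yet it contains the external column.\<close>
  have "U \<noteq> {}"
  proof
    assume "U = {}"
    then have "closure (interior \<gamma>) \<subseteq> C"
      using C by (intro closure_minimal) (auto simp: U_def)
    then have "\<gamma> \<subseteq> C"
      using convex_closure_interior[OF \<open>convex \<gamma>\<close> \<open>interior \<gamma> \<noteq> {}\<close>] closure_subset by blast
    then show False
      using j \<open>real_vec (column j A) \<in> \<gamma>\<close> by blast
  qed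
  have scale: "c *\<^sub>R x \<in> U" if "0 < c" "x \<in> U" for c x
  proof -
    \<comment> \<open>Scaling sends the interior to an open subset of \<gamma>, hence into the
      interior.\<close>
    have "(*\<^sub>R) c ` interior \<gamma> \<subseteq> \<gamma>"
      using interior_subset \<gamma>(2) \<open>0 < c\<close> by (force intro: convex_cone_scaleR)
    moreover have "open ((*\<^sub>R) c ` interior \<gamma>)"
      using \<open>0 < c\<close> by (simp add: open_scaling)
    ultimately have "c *\<^sub>R x \<in> interior \<gamma>"
      using that unfolding U_def by (meson DiffD1 imageI interior_maximal subsetD)
    moreover have "c *\<^sub>R x \<notin> C"
    proof
      assume "c *\<^sub>R x \<in> C"
      from convex_cone_scaleR[OF C(1) _ this, of "inverse c"] show False
        using that by (simp add: U_def)
    qed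
    ultimately show ?thesis by (simp add: U_def)
  qed
  have eq: "P b = P (b - column j A)"
    if "real_vec b \<in> U" "real_vec (b - column j A) \<in> U" for b
  proof -
    have "real_vec b \<in> \<gamma>" "real_vec (b - column j A) \<in> \<gamma>" "real_vec b \<notin> C"
      using that interior_subset by (auto simp: U_def)
    then show ?thesis
      using P partition_fun_minus_column[of b A j]
      by (simp add: chamber_quasi_polynomial_def C_def)
  qed
  have "quasi_polynomial P"
    using P by (simp add: chamber_quasi_polynomial_def)
  then show ?thesis
    by (rule quasi_polynomial_invariant_translation[OF _ \<open>open U\<close> \<open>U \<noteq> {}\<close>])
      (erule (1) scale, erule (1) eq)
qed

section \<open>The determinant formula via coordinates along the ray generators\<close>

theorem theorem5p1:
  fixes A :: "int^'n^'d"
    and \<gamma> :: "(real^'d) set"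
    and k :: 'd
    and e :: "'d \<Rightarrow> 'n"
    and v :: "'d \<Rightarrow> int^'d"
    and P :: "int^'d \<Rightarrow> real"
  assumes rank_A: "rank (real_mat A) = CARD('d)"
    and ker_A: "{x. real_mat A *v x = 0} \<inter> {x. \<forall>j. 0 \<le> x $ j} = {0}"
    and external: "external_chamber A \<gamma>"
    and inj_e: "inj_on e (- {k})"
    and ext_cols: "external_columns_of A \<gamma> = e ` (- {k})"
    and saturated: "saturated_in (cols A (e ` (- {k}))) (lattice_gen (cols A UNIV))"
    and external_gens: "\<And>i. i \<noteq> k \<Longrightarrow> pos {v i} = pos {column (e i) A}"
    and internal_gen: "internal_ray A \<gamma> (pos {v k})"
    and P: "chamber_quasi_polynomial A \<gamma> P"
  shows "\<exists>h. ehrhart_quasi_polynomial A (v k) h \<and>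
    (\<forall>b \<in> semigroup_gen (cols A UNIV). real_vec b \<in> \<gamma> \<longrightarrow>
      P b = h (real_of_int (det_columns (v(k := b))) / real_of_int (det_columns v)))"
proof -
  define L where "L = lattice_gen (cols A UNIV)"
  define S where "S = cols A (e ` (- {k}))"
  define V :: "real^'d^'d" where "V = (\<chi> i j. real_of_int (v j $ i))"
  have L: "b + m *s w \<in> L" if "b \<in> L" "w \<in> L" for b w m
    using that unfolding L_def by (rule lattice_gen_add_smult)
  have \<gamma>: "chamber A \<gamma>"
    using external by (simp add: external_chamber_def)
  have ray_k: "ray_of (pos {v k}) \<gamma>"
    using internal_gen by (simp add: internal_ray_def)
  have cone: "convex_cone \<gamma>"
    using chamber_cone[OF \<gamma> ray_k] by metis

  have V_column: "column i V = real_vec (v i)" for i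
    by (simp add: V_def column_def real_vec_def vec_eq_iff)
  have "columns V = range (\<lambda>i. real_vec (v i))"
    by (auto simp: columns_def V_column)
  then have "vec.span (columns V) = UNIV"
    using external_chamber_spanned[OF external ext_cols external_gens internal_gen]
    by (simp add: span_vec_eq)
  then obtain W where W: "V ** W = mat 1"
    using matrix_right_invertible_span_columns by blast
  then have det_V: "det V \<noteq> 0"
    using invertible_det_nz invertible_right_inverse by blast
  \<comment> \<open>\<open>W\<close> computes coordinates in the basis of the \<open>v i\<close>;
    \<rho> is the one along the internal generator.\<close>
  define \<rho> where "\<rho> x = (W *v x) $ k" for x
  have det_v: "real_of_int (det_columns v) = det V"
    by (simp add: det_columns_eq_det V_def)
  have V_inverse: "V *v (W *v x) = x" for x
    by (simp add: matrix_vector_mul_assoc W)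
  have "linear \<rho>"
    unfolding \<rho>_def by (rule linearI) (simp_all add: matrix_vector_right_distrib matrix_vector_mult_scaleR)
  have \<rho>_det: "real_of_int (det_columns (v(k := b))) = \<rho> (real_vec b) * det V" for b
  proof -
    \<comment> \<open>Writing \<open>b\<close> as \<open>V\<close> applied to its coordinate vector
      gives the shape required by Cramer's rule.\<close>
    have "(\<chi> i j. real_of_int ((v(k := b)) j $ i)) =
        (\<chi> i j. if j = k then (V *v (W *v real_vec b)) $ i else V $ i $ j)"
      unfolding V_inverse by (simp add: V_def real_vec_def vec_eq_iff)
    then show ?thesis
      unfolding det_columns_eq_det \<rho>_def by (simp only: cramer_lemma)
  qed
  have \<rho>_v: "\<rho> (real_vec (v k)) = 1"
    using \<rho>_det[of "v k"] det_v det_V by simp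

  have P_add: "P (b + u) = P b" if "u \<in> S" for u b
  proof -
    have "u \<in> (\<lambda>j. column j A) ` external_columns_of A \<gamma>"
      using that by (simp only: S_def cols_def ext_cols)
    then obtain j where j: "j \<in> external_columns_of A \<gamma>" "u = column j A"
      by (rule imageE)
    have "P (b + u) = P (b + u - column j A)"
      using P \<gamma> cone j(1) by (rule chamber_quasi_polynomial_minus_external_column)
    also have "b + u - column j A = b"
      by (simp add: j(2))
    finally show ?thesis .
  qed
  have P_eq: "P b = P b'" if b: "b \<in> L" "b' \<in> L" and eq: "\<rho> (real_vec b) = \<rho> (real_vec b')" for b b'
  proof -
    define c where "c = b - b'"
    have "c = b + (- 1) *s b'"
      unfolding c_def vec_eq_iff by simp
    then have "c \<in> L"
      using L[OF b] by (simp only:)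
    \<comment> \<open>In this expansion the coordinate at \<open>k\<close> is \<rho> of
      \<open>c\<close>, which vanishes, and every other \<open>v i\<close> is a multiple of an
      external column.\<close>
    have "real_vec c = (\<Sum>i\<in>UNIV. (W *v real_vec c) $ i *\<^sub>R real_vec (v i))"
      using V_inverse[of "real_vec c"] by (simp add: matrix_mult_sum V_column scalar_mult_eq_scaleR)
    also have "\<dots> \<in> span (real_vec ` S)"
    proof (intro span_sum)
      fix i
      show "(W *v real_vec c) $ i *\<^sub>R real_vec (v i) \<in> span (real_vec ` S)"
      proof (cases "i = k")
        case True
        have "\<rho> (real_vec c) = 0"
          using eq \<open>linear \<rho>\<close> by (simp add: c_def real_vec_diff linear_diff)
        then show ?thesis
          using True by (simp add: \<rho>_def span_zero)
      next
        case False
        then have "real_vec (v i) \<in> pos {column (e i) A}"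
          using external_gens[of i] real_vec_in_pos[of "{v i}" "v i"] by simp
        then have "real_vec (v i) \<in> span {real_vec (column (e i) A)}"
          using pos_subset_span[of "{column (e i) A}"] by auto
        also have "\<dots> \<subseteq> span (real_vec ` S)"
          using False by (intro span_mono) (auto simp: S_def cols_def)
        finally show ?thesis
          by (rule span_scale)
      qed
    qed
    finally have "real_vec c \<in> span (real_vec ` S)" .
    moreover have "S \<subseteq> L"
      unfolding S_def L_def by (auto simp: cols_def intro: lattice_gen_base)
    moreover have "saturated_in S L"
      using saturated by (simp add: S_def L_def)
    moreover have "finite S"
      by (simp add: S_def)
    ultimately obtain m where m: "c + (\<Sum>u\<in>S. int m *s u) \<in> semigroup_gen S"
      using saturated_lattice_Int_span[of S L c] L \<open>c \<in> L\<close> by metis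
    have "(\<Sum>u\<in>S. int m *s u) \<in> semigroup_gen S"
      unfolding semigroup_gen_def by (auto intro!: exI[of _ "\<lambda>_. m"])
    \<comment> \<open>Adding semigroup elements to \<open>b\<close> and to \<open>b'\<close> leads
      to the same point.\<close>
    then have "P b = P (b + (\<Sum>u\<in>S. int m *s u))"
      using invariant_semigroup_gen[of S P] P_add by metis
    also have "\<dots> = P (b' + (c + (\<Sum>u\<in>S. int m *s u)))"
      by (simp add: c_def)
    also have "\<dots> = P b'"
      using invariant_semigroup_gen[of S P] P_add m by metis
    finally show ?thesis .
  qed

  \<comment> \<open>The generator \<open>v k\<close> need not lie in \<open>L\<close>, so a lattice
    vector with positive integral \<rho> is built from a column of \<open>A\<close>.\<close>
  obtain w n where w: "w \<in> L" "\<rho> (real_vec w) = real n" "n > 0"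
  proof -
    \<comment> \<open>The columns span the whole space, while \<rho> is 1 at
      \<open>v k\<close>.\<close>
    have "\<exists>j. \<rho> (real_vec (column j A)) \<noteq> 0"
    proof (rule ccontr)
      assume "\<not> ?thesis"
      then have "columns (real_mat A) \<subseteq> {x. \<rho> x = 0}"
        by (auto simp: columns_def real_vec_column)
      moreover have "subspace {x. \<rho> x = 0}"
        using \<open>linear \<rho>\<close> by (rule linear_subspace_kernel)
      ultimately have "span (columns (real_mat A)) \<subseteq> {x. \<rho> x = 0}"
        by (rule span_minimal)
      moreover have "span (columns (real_mat A)) = UNIV"
        using rank_A dim_eq_full[of "columns (real_mat A)"] by (simp add: column_rank_def)
      ultimately have "\<rho> (real_vec (v k)) = 0" by blast
      then show False using \<rho>_v by simp
    qed
    then obtain j where j: "\<rho> (real_vec (column j A)) \<noteq> 0" by blast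
    define a where "a = column j A"
    have a: "a \<in> L"
      unfolding L_def a_def by (rule lattice_gen_base) (auto simp: cols_def)
    \<comment> \<open>By Cramer's rule \<rho> of \<open>a\<close> is a quotient of integers;
      multiplying by its denominator and its numerator leaves the square of a nonzero
      integer.\<close>
    define D where "D = det_columns v * det_columns (v(k := a))"
    have "\<rho> (real_vec (D *s a)) = (real_of_int (det_columns (v(k := a))))\<^sup>2"
      using \<open>linear \<rho>\<close> \<rho>_det[of a] det_v
      by (simp add: D_def real_vec_smult linear_scale power2_eq_square)
    also have "\<dots> = real (nat ((det_columns (v(k := a)))\<^sup>2))"
      by simp
    finally have "\<rho> (real_vec (D *s a)) = real (nat ((det_columns (v(k := a)))\<^sup>2))" .
    moreover have "det_columns (v(k := a)) \<noteq> 0"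
      using \<rho>_det[of a] j det_V by (auto simp: a_def)
    moreover have "D *s a \<in> L"
      using L[OF a a, of "D - 1"] by (simp add: vec_eq_iff algebra_simps)
    ultimately show thesis
      by (intro that[of "D *s a" "nat ((det_columns (v(k := a)))\<^sup>2)"]) auto
  qed
  have "quasi_polynomial P"
    using P by (simp add: chamber_quasi_polynomial_def)
  then obtain h where h: "quasi_polynomial_1 h" "\<And>b. b \<in> L \<Longrightarrow> h (\<rho> (real_vec b)) = P b"
    using quasi_polynomial_descends[OF _ \<open>linear \<rho>\<close> _ _ w, of P] L P_eq by blast
  have "ehrhart_quasi_polynomial A (v k) h"
    unfolding ehrhart_quasi_polynomial_def
  proof (intro conjI allI ballI impI)
    fix t w assume t: "0 \<le> t" "w \<in> lattice_gen (cols A UNIV)" "real_vec w = t *\<^sub>R real_vec (v k)"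
    have "\<rho> (real_vec w) = t"
      using t(3) \<rho>_v \<open>linear \<rho>\<close> by (simp add: linear_scale)
    then have "h t = P w"
      using h(2)[of w] t(2) by (simp add: L_def)
    \<comment> \<open>Nonnegative multiples of \<open>v k\<close> stay on the internal ray, hence in
      \<gamma>, where \<open>P\<close> is the partition function.\<close>
    moreover have "real_vec w \<in> pos {v k}"
      using t unfolding pos_singleton by auto
    then have "real_vec w \<in> \<gamma>"
      using ray_k face_of_imp_subset unfolding ray_of_def by blast
    ultimately show "h t = real (partition_fun A w)"
      using P by (simp add: chamber_quasi_polynomial_def)
  qed (rule h(1))
  moreover have "P b = h (real_of_int (det_columns (v(k := b))) / real_of_int (det_columns v))"
    if "b \<in> semigroup_gen (cols A UNIV)" for b
  proof -
    have "b \<in> L"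
      using that semigroup_gen_subset_lattice_gen unfolding L_def by (rule subsetD[rotated])
    moreover have "real_of_int (det_columns (v(k := b))) / real_of_int (det_columns v) = \<rho> (real_vec b)"
      unfolding \<rho>_det[of b] det_v using det_V by (rule nonzero_mult_div_cancel_right)
    ultimately show ?thesis
      using h(2)[of b] by metis
  qed
  ultimately show ?thesis by blast
qed

end
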